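(* Let $S$ be an inverse semigroup such that $E(S)$ is isomorphic to $(\mathbb N,\geq)$ and let $K$ be a commutative ring with unit. Then every non-zero $KS$-module is spectral.
   Context: An inverse semigroup is a semigroup $S$ such that each $s\in S$ has a unique $s^*$ with $ss^*s=s$, $s^*ss^*=s^*$. $E(S)$ is its commutative semigroup of idempotents, ordered by $e\le f$ iff $ef=e$; $s\le t$ iff $s=et$ for some $e\in E(S)$. $E(S)\cong(\mathbb N,\ge)$ means $E(S)=\{e_i\mid i\in\mathbb N\}$ (distinct) with $e_ie_j=e_{\max\{i,j\}}$, where $0\in\mathbb N$. Modules $V$ over a $K$-algebra $A$ are assumed non-degenerate, i.e. $AV=V$. $\widehat{E(S)}$ is the space of non-zero semilattice homomorphisms $\theta\colon E(S)\to\{0,1\}$ with the subspace topology from $\{0,1\}^{E(S)}$; $D(e)=\{\theta\mid\theta(e)=1\}$. Each $s\in S$ acts by the homeomorphism $D(s^*s)\to D(ss^* )$, $(s\theta)(e)=\theta(s^*es)$. The universal groupoid $\mathscr G=\mathscr G(S)$ is the set of classes $[s,\theta]$ of pairs with $\theta\in D(s^*s)$, where $(s,\theta)\sim(t,\theta')$ iff $\theta=\theta'$ and there is $u\le s,t$ with $\theta\in D(u^*u)$. It has basic open sets $(s,U)=\{[s,\theta]\mid\theta\in U\}$ ($U\subseteq D(s^*s)$ open), product $[s,\theta][t,\theta']=[st,\theta']$ defined iff $t\theta'=\theta$, $d([s,\theta])=\theta$, $r([s,\theta])=s\theta$, unit space $\mathscr G^0=\widehat{E(S)}$. With $K$ discrete,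 $K\mathscr G$ is the $K$-module of functions $\mathscr G\to K$ spanned by those $f$ for which there is an open Hausdorff subspace $V$ such that $f$ vanishes off $V$ and $f|_V$ is continuous with compact support, with product $f\ast g(x)=\sum_{y\in d^{-1}(d(x))}f(xy^{-1})g(y)$. The map $s\mapsto\chi_{(s,D(s^*s))}$ extends to a $K$-algebra isomorphism $KS\to K\mathscr G(S)$, through which $KS$-modules are viewed as $K\mathscr G(S)$-modules. For a $K\mathscr G$-module $V$ and $\theta\in\mathscr G^0$, $\mathrm{Res}_\theta(V)=\bigcap_U\chi_UV$, over all compact open $U\subseteq\mathscr G^0$ containing $\theta$; a non-zero $V$ is spectral if $\mathrm{Res}_\theta(V)\neq0$ for some $\theta$. *)

theory Defs
  imports
    "HOL-Analysis.Analysis"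
    "HOL-Library.Poly_Mapping"
    "HOL-Library.Function_Algebras"
begin

section \<open>Inverse semigroups\<close>

class inverse_semigroup = semigroup_mult +
  assumes ex1_inverse: "\<exists>!t. s * t * s = s \<and> t * s * t = t"

definition star :: "'s::inverse_semigroup \<Rightarrow> 's" where
  "star s = (THE t. s * t * s = s \<and> t * s * t = t)"

definition idempotents :: "'s::inverse_semigroup set" where
  "idempotents = {e. e * e = e}"

definition nat_le :: "'s::inverse_semigroup \<Rightarrow> 's \<Rightarrow> bool" where
  "nat_le s t \<longleftrightarrow> (\<exists>e\<in>idempotents. s = e * t)"

text \<open>The semilattice of idempotents of \<open>'s\<close> is isomorphic to the naturals under the reverse
  order, where meets are maxima.\<close>

definition idempotents_iso_nat_ge :: "'s::inverse_semigroup itself \<Rightarrow> bool" where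
  "idempotents_iso_nat_ge _ \<longleftrightarrow>
     (\<exists>e :: nat \<Rightarrow> 's. bij_betw e UNIV idempotents \<and> (\<forall>i j. e i * e j = e (max i j)))"


section \<open>The spectrum of the semilattice of idempotents\<close>

text \<open>Characters are extensional functions on the set of idempotents, so that the spectrum is a
  subset of the carrier of the product topology on \<open>{0, 1}\<close> to the power of that set.\<close>

definition spectrum :: "('s::inverse_semigroup \<Rightarrow> nat) set" where
  "spectrum = {\<theta> \<in> idempotents \<rightarrow>\<^sub>E {0, 1}.
     (\<forall>e\<in>idempotents. \<forall>f\<in>idempotents. \<theta> (e * f) = \<theta> e * \<theta> f) \<and>
     (\<exists>e\<in>idempotents. \<theta> e \<noteq> 0)}"

definition spectrum_topology :: "('s::inverse_semigroup \<Rightarrow> nat) topology" where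
  "spectrum_topology =
     subtopology (product_topology (\<lambda>_. discrete_topology {0, 1}) idempotents) spectrum"

definition D :: "'s::inverse_semigroup \<Rightarrow> ('s \<Rightarrow> nat) set" where
  "D e = {\<theta> \<in> spectrum. \<theta> e = 1}"


section \<open>The universal groupoid\<close>

type_synonym 's germ = "('s \<times> ('s \<Rightarrow> nat)) set"

definition germ_rel :: "(('s::inverse_semigroup \<times> ('s \<Rightarrow> nat)) \<times> ('s \<times> ('s \<Rightarrow> nat))) set" where
  "germ_rel = {((s, \<theta>), (t, \<theta>')). \<theta> \<in> D (star s * s) \<and> \<theta>' \<in> D (star t * t) \<and>
     \<theta> = \<theta>' \<and> (\<exists>u. nat_le u s \<and> nat_le u t \<and> \<theta> \<in> D (star u * u))}"

definition germ :: "'s::inverse_semigroup \<Rightarrow> ('s \<Rightarrow> nat) \<Rightarrow> 's germ" where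
  "germ s \<theta> = germ_rel `` {(s, \<theta>)}"

definition groupoid :: "'s::inverse_semigroup germ set" where
  "groupoid = {(s, \<theta>). \<theta> \<in> D (star s * s)} // germ_rel"

definition bisection :: "'s::inverse_semigroup \<Rightarrow> ('s \<Rightarrow> nat) set \<Rightarrow> 's germ set" where
  "bisection s U = germ s ` U"

definition groupoid_topology :: "'s::inverse_semigroup germ topology" where
  "groupoid_topology = topology_generated_by
     {bisection s U | s U. openin spectrum_topology U \<and> U \<subseteq> D (star s * s)}"

text \<open>The spectrum is the unit space of the groupoid: a character \<open>\<theta>\<close> is identified with the germ
  at \<open>\<theta>\<close> of any idempotent \<open>e\<close> with \<open>\<theta> e = 1\<close>.\<close>

definition unit_germs :: "('s::inverse_semigroup \<Rightarrow> nat) set \<Rightarrow> 's germ set" where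
  "unit_germs U = (\<Union>e\<in>idempotents. bisection e (U \<inter> D e))"


section \<open>The groupoid algebra\<close>

text \<open>The groupoid need not be Hausdorff, so continuity and compact support are only required on
  open Hausdorff subspaces. A function on the groupoid is represented by the function on the whole
  type of sets of pairs that is zero outside the groupoid.\<close>

definition groupoid_algebra :: "('s::inverse_semigroup germ \<Rightarrow> 'k::comm_ring_1) set" where
  "groupoid_algebra = module.span (\<lambda>c f x. c * f x)
     {f. \<exists>V. openin groupoid_topology V \<and> Hausdorff_space (subtopology groupoid_topology V) \<and>
       (\<forall>x. x \<notin> V \<longrightarrow> f x = 0) \<and>
       continuous_map (subtopology groupoid_topology V) (discrete_topology UNIV) f \<and>
       compactin (subtopology groupoid_topology V)
         (subtopology groupoid_topology V closure_of {x \<in> V. f x \<noteq> 0})}"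


section \<open>The semigroup algebra and its modules\<close>

text \<open>Elements of the semigroup algebra are finitely supported functions. The multiplication that
  the type of such functions carries in the library is for additively written monoids.\<close>

definition sg_mult ::
  "('s::inverse_semigroup \<Rightarrow>\<^sub>0 'k::comm_ring_1) \<Rightarrow> ('s \<Rightarrow>\<^sub>0 'k) \<Rightarrow> ('s \<Rightarrow>\<^sub>0 'k)" where
  "sg_mult a b = (\<Sum>s\<in>Poly_Mapping.keys a. \<Sum>t\<in>Poly_Mapping.keys b. Poly_Mapping.single (s * t) (Poly_Mapping.lookup a s * Poly_Mapping.lookup b t))"

locale semigroup_algebra_module = module scale
  for scale :: "'k::comm_ring_1 \<Rightarrow> 'v::ab_group_add \<Rightarrow> 'v" +
  fixes act :: "('s::inverse_semigroup \<Rightarrow>\<^sub>0 'k) \<Rightarrow> 'v \<Rightarrow> 'v"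
  assumes act_add_left: "act (a + b) v = act a v + act b v"
    and act_add_right: "act a (v + w) = act a v + act a w"
    and act_scale_left: "act (Poly_Mapping.map ((*) c) a) v = scale c (act a v)"
    and act_scale_right: "act a (scale c v) = scale c (act a v)"
    and act_mult: "act (sg_mult a b) v = act a (act b v)"
    and nondegenerate: "module.span scale {act a v | a v. True} = UNIV"


section \<open>From semigroup algebra modules to groupoid algebra modules\<close>

text \<open>The linear extension of the map sending \<open>s\<close> to the characteristic function of
  \<open>bisection s (D (star s * s))\<close>. It is an algebra isomorphism of the semigroup
  algebra onto \<^const>\<open>groupoid_algebra\<close> with the convolution product; injectivity, proved
  below, makes its inverse unambiguous on its range. A module over the semigroup algebra becomes a
  module over the groupoid algebra by transport along the inverse, so the convolution product itself
  does not occur.\<close>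

definition to_groupoid_algebra ::
  "('s::inverse_semigroup \<Rightarrow>\<^sub>0 'k::comm_ring_1) \<Rightarrow> ('s germ \<Rightarrow> 'k)" where
  "to_groupoid_algebra a =
     (\<lambda>x. \<Sum>s\<in>Poly_Mapping.keys a. Poly_Mapping.lookup a s * indicator (bisection s (D (star s * s))) x)"

definition groupoid_act ::
  "(('s::inverse_semigroup \<Rightarrow>\<^sub>0 'k::comm_ring_1) \<Rightarrow> 'v \<Rightarrow> 'v) \<Rightarrow> ('s germ \<Rightarrow> 'k) \<Rightarrow> 'v \<Rightarrow> 'v" where
  "groupoid_act act = (\<lambda>f\<in>groupoid_algebra. act (inv to_groupoid_algebra f))"


section \<open>Spectral modules\<close>

text \<open>Here \<open>act\<close> is the action of the groupoid algebra.\<close>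

definition Res ::
  "(('s::inverse_semigroup germ \<Rightarrow> 'k::comm_ring_1) \<Rightarrow> 'v::ab_group_add \<Rightarrow> 'v) \<Rightarrow> ('s \<Rightarrow> nat) \<Rightarrow> 'v set"
  where
  "Res act \<theta> = (\<Inter>U\<in>{U. openin spectrum_topology U \<and> compactin spectrum_topology U \<and> \<theta> \<in> U}.
     range (act (indicator (unit_germs U))))"

definition spectral ::
  "(('s::inverse_semigroup germ \<Rightarrow> 'k::comm_ring_1) \<Rightarrow> 'v::ab_group_add \<Rightarrow> 'v) \<Rightarrow> bool" where
  "spectral act \<longleftrightarrow> (\<exists>v::'v. v \<noteq> 0) \<and> (\<exists>\<theta>\<in>spectrum. Res act \<theta> \<noteq> {0})"


section \<open>Consistency of the encodings\<close>

lemma star_props: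
  fixes s :: "'s::inverse_semigroup"
  shows "s * star s * s = s" "star s * s * star s = star s"
  using theI'[OF ex1_inverse[of s]] unfolding star_def by auto

lemma star_unique:
  fixes s :: "'s::inverse_semigroup"
  assumes "s * t * s = s" "t * s * t = t"
  shows "star s = t"
  using ex1_inverse[of s] star_props[of s] assms by blast

lemma star_idem:
  fixes e :: "'s::inverse_semigroup"
  assumes "e \<in> idempotents"
  shows "star e = e"
  using assms by (intro star_unique) (auto simp: idempotents_def)

lemma star_star:
  fixes s :: "'s::inverse_semigroup"
  shows "star (star s) = s"
  by (intro star_unique star_props)

lemma idem_mult:
  fixes e f :: "'s::inverse_semigroup"
  assumes "e \<in> idempotents" "f \<in> idempotents"
  shows "e * f \<in> idempotents"
proof -
  have e: "e * e = e" "\<And>x. e * (e * x) = e * x" and f: "f * f = f" "\<And>x. f * (f * x) = f * x"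
    using assms by (auto simp: idempotents_def simp flip: mult.assoc)
  define x where "x = star (e * f)"
  have 1: "e * (f * (x * (e * f))) = e * f" and 2: "x * (e * (f * x)) = x"
    using star_props[of "e * f"] by (auto simp: x_def mult.assoc)
  have 3: "x * (e * (f * (x * y))) = x * y" for y
    using 2 by (metis mult.assoc)
  have "star (e * f) = f * (x * e)"
    by (intro star_unique) (simp_all add: mult.assoc e f 1 3)
  then have x: "x = f * (x * e)"
    by (simp only: flip: x_def)
  have "x * x = (f * (x * e)) * (f * (x * e))"
    by (rule arg_cong2[OF x x])
  also have "\<dots> = f * (x * e)"
    by (simp add: mult.assoc 3)
  also have "\<dots> = x"
    by (rule x[symmetric])
  finally have "x \<in> idempotents"
    by (simp add: idempotents_def)
  moreover have "e * f = star x"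
    by (simp add: x_def star_star)
  ultimately show ?thesis
    by (simp add: star_idem)
qed

lemma idem_commute:
  fixes e f :: "'s::inverse_semigroup"
  assumes "e \<in> idempotents" "f \<in> idempotents"
  shows "e * f = f * e"
proof -
  have e: "e * e = e" "\<And>x. e * (e * x) = e * x" and f: "f * f = f" "\<And>x. f * (f * x) = f * x"
    using assms by (auto simp: idempotents_def simp flip: mult.assoc)
  have ef: "e * (f * (e * f)) = e * f" and fe: "f * (e * (f * e)) = f * e"
    using idem_mult[OF assms] idem_mult[OF assms(2,1)] by (simp_all add: idempotents_def mult.assoc)
  have "star (e * f) = f * e"
    by (intro star_unique) (simp_all add: mult.assoc e f ef fe)
  then show ?thesis
    using star_idem[OF idem_mult[OF assms]] by simp
qed

lemma star_mult_idem:
  fixes s :: "'s::inverse_semigroup"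
  shows "star s * s \<in> idempotents" "s * star s \<in> idempotents"
  using star_props[of s] by (simp_all add: idempotents_def flip: mult.assoc)

lemma topspace_groupoid_topology:
  "topspace (groupoid_topology :: 's::inverse_semigroup germ topology) = groupoid"
proof -
  have "openin spectrum_topology (D e)" if "e \<in> idempotents" for e :: 's
  proof -
    let ?P = "product_topology (\<lambda>_. discrete_topology {0, 1::nat}) (idempotents :: 's set)"
    have "continuous_map ?P (discrete_topology {0, 1}) (\<lambda>\<theta>. \<theta> e)"
      using that by (rule continuous_map_product_projection)
    then have "openin ?P {\<theta> \<in> topspace ?P. \<theta> e \<in> {1}}"
      by (rule openin_continuous_map_preimage) simp
    moreover have "D e = {\<theta> \<in> topspace ?P. \<theta> e \<in> {1}} \<inter> spectrum"
      by (auto simp: D_def spectrum_def)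
    ultimately show ?thesis
      unfolding spectrum_topology_def openin_subtopology by blast
  qed
  then have open_D: "openin spectrum_topology (D (star s * s))" for s :: 's
    using star_mult_idem(1) by blast
  have "(groupoid :: 's germ set) = (\<Union>s. bisection s (D (star s * s)))"
    unfolding groupoid_def quotient_def bisection_def germ_def by blast
  also have "\<dots> = topspace groupoid_topology"
    unfolding groupoid_topology_def topology_generated_by_topspace
  proof (intro equalityI subsetI)
    fix x assume "x \<in> (\<Union>s::'s. bisection s (D (star s * s)))"
    then show "x \<in> \<Union> {bisection s U | s U. openin spectrum_topology U \<and> U \<subseteq> D (star s * s)}"
      using open_D by blast
  qed (auto simp: bisection_def)
  finally show ?thesis ..
qed

lemma nat_le_right:
  fixes u s :: "'s::inverse_semigroup"
  assumes "nat_le u s"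
  shows "u = s * (star u * u)"
proof -
  obtain e where e: "e \<in> idempotents" and u: "u = e * s"
    using assms by (auto simp: nat_le_def)
  have ee: "e * e = e" "\<And>x. e * (e * x) = e * x"
    using e by (auto simp: idempotents_def simp flip: mult.assoc)
  have c: "s * (star s * (e * x)) = e * (s * (star s * x))" for x
    using arg_cong[OF idem_commute[OF e star_mult_idem(2)[of s]], of "\<lambda>y. y * x"]
    by (simp add: mult.assoc)
  have ss: "s * (star s * s) = s" "star s * (s * star s) = star s"
    using star_props[of s] by (simp_all add: mult.assoc)
  have "star u = star s * e"
  proof (rule star_unique)
    show "u * (star s * e) * u = u"
      by (simp only: u mult.assoc ee c ss)
    have "star s * e * u * (star s * e) = star s * (e * (s * (star s * e)))"
      by (simp add: u mult.assoc ee)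
    also have "e * (s * (star s * e)) = s * (star s * (e * e))"
      by (rule c[symmetric])
    finally show "star s * e * u * (star s * e) = star s * e"
      using star_props(2)[of s] by (simp only: ee(1) flip: mult.assoc)
  qed
  then have "s * (star u * u) = s * (star s * (e * s))"
    by (simp only: u mult.assoc ee)
  also have "\<dots> = u"
    by (simp only: u c ss)
  finally show ?thesis ..
qed

lemma nat_le_antisym:
  fixes s t :: "'s::inverse_semigroup"
  assumes "nat_le s t" "nat_le t s"
  shows "s = t"
proof -
  obtain e where e: "e \<in> idempotents" "s = e * t"
    using assms(1) unfolding nat_le_def by blast
  obtain f where f: "f \<in> idempotents" "t = f * s"
    using assms(2) unfolding nat_le_def by blast
  have "e * e = e"
    using e(1) by (simp add: idempotents_def)
  then have "e * s = s"
    using e(2) by (metis mult.assoc)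
  then have "f * (e * s) = t"
    using f(2) by simp
  moreover have "f * (e * s) = e * (f * s)"
    using idem_commute[OF e(1) f(1)] by (metis mult.assoc)
  ultimately show ?thesis
    using e(2) f(2) by metis
qed

lemma nat_le_trans:
  fixes s t u :: "'s::inverse_semigroup"
  assumes "nat_le s t" "nat_le t u"
  shows "nat_le s u"
  using assms idem_mult unfolding nat_le_def by (metis mult.assoc)

lemma nat_le_refl: "nat_le s (s :: 's::inverse_semigroup)"
  unfolding nat_le_def using star_mult_idem(2)[of s] star_props(1)[of s] by metis

definition principal_char :: "'s::inverse_semigroup \<Rightarrow> 's \<Rightarrow> nat" where
  "principal_char e = (\<lambda>f\<in>idempotents. if e * f = e then 1 else 0)"

lemma principal_char_in_D:
  fixes e :: "'s::inverse_semigroup"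
  assumes "e \<in> idempotents"
  shows "principal_char e \<in> D e"
proof -
  have "(e * (f * g) = e) \<longleftrightarrow> e * f = e \<and> e * g = e"
    if "f \<in> idempotents" "g \<in> idempotents" for f g
  proof
    assume a: "e * (f * g) = e"
    have "f * f = f" "g * g = g"
      using that by (auto simp: idempotents_def)
    then show "e * f = e \<and> e * g = e"
      using a idem_commute[OF that] by (metis mult.assoc)
  qed (metis mult.assoc)
  moreover have "e * e = e"
    using assms by (simp add: idempotents_def)
  ultimately show ?thesis
    using assms by (auto simp: D_def spectrum_def principal_char_def idem_mult)
qed

lemma germ_eq_imp_nat_le:
  fixes s t :: "'s::inverse_semigroup"
  assumes "germ s (principal_char (star s * s)) = germ t \<theta>"
  shows "nat_le s t"
proof -
  let ?p = "principal_char (star s * s)"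
  have p: "?p \<in> D (star s * s)"
    by (rule principal_char_in_D[OF star_mult_idem(1)])
  then have "(s, ?p) \<in> germ s ?p"
    using nat_le_refl by (auto simp: germ_def germ_rel_def)
  then have "((t, \<theta>), (s, ?p)) \<in> germ_rel"
    unfolding assms by (simp add: germ_def)
  then obtain u where u: "nat_le u s" "nat_le u t" "?p \<in> D (star u * u)"
    by (auto simp: germ_rel_def)
  then have "star s * s * (star u * u) = star s * s"
    using star_mult_idem(1)[of u] by (auto simp: D_def principal_char_def split: if_splits)
  then have "s * (star u * u) = s"
    using star_props(1)[of s] by (metis mult.assoc)
  then show ?thesis
    using nat_le_right[OF u(1)] u(2) by simp
qed

theorem inj_to_groupoid_algebra:
  "inj (to_groupoid_algebra :: ('s::inverse_semigroup \<Rightarrow>\<^sub>0 'k::comm_ring_1) \<Rightarrow> _)"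
proof (rule injI)
  fix a b :: "'s \<Rightarrow>\<^sub>0 'k"
  assume eq: "to_groupoid_algebra a = to_groupoid_algebra b"
  have ext: "to_groupoid_algebra c x =
      (\<Sum>s\<in>Poly_Mapping.keys a \<union> Poly_Mapping.keys b. Poly_Mapping.lookup c s * indicator (bisection s (D (star s * s))) x)"
    if "Poly_Mapping.keys c \<subseteq> Poly_Mapping.keys a \<union> Poly_Mapping.keys b" for c :: "'s \<Rightarrow>\<^sub>0 'k" and x
    unfolding to_groupoid_algebra_def
    using that by (intro sum.mono_neutral_left) (auto simp: in_keys_iff)
  define I where "I = {s \<in> Poly_Mapping.keys a \<union> Poly_Mapping.keys b. Poly_Mapping.lookup a s \<noteq> Poly_Mapping.lookup b s}"
  have zero: "(\<Sum>s\<in>I. (Poly_Mapping.lookup a s - Poly_Mapping.lookup b s) * indicator (bisection s (D (star s * s))) x) = 0"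
    for x
  proof -
    have "(\<Sum>s\<in>Poly_Mapping.keys a \<union> Poly_Mapping.keys b.
        (Poly_Mapping.lookup a s - Poly_Mapping.lookup b s) * indicator (bisection s (D (star s * s))) x) = 0"
      using fun_cong[OF eq, of x] by (simp add: ext algebra_simps sum_subtractf)
    moreover have "(\<Sum>s\<in>I. (Poly_Mapping.lookup a s - Poly_Mapping.lookup b s) * indicator (bisection s (D (star s * s))) x)
      = (\<Sum>s\<in>Poly_Mapping.keys a \<union> Poly_Mapping.keys b.
        (Poly_Mapping.lookup a s - Poly_Mapping.lookup b s) * indicator (bisection s (D (star s * s))) x)"
      by (intro sum.mono_neutral_left) (auto simp: I_def)
    ultimately show ?thesis
      by simp
  qed
  have fin: "finite I"
    by (simp add: I_def)
  have "I = {}"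
  proof (rule ccontr)
    assume "I \<noteq> {}"
    have "\<exists>m\<in>I. \<forall>t\<in>I. nat_le m t \<longrightarrow> t = m"
    proof -
      let ?R = "\<lambda>x y. nat_le x y \<and> x \<noteq> (y :: 's)"
      have "transp_on I ?R"
        by (rule transp_onI) (metis nat_le_trans nat_le_antisym)
      moreover have "asymp_on I ?R"
        by (rule asymp_onI) (metis nat_le_antisym)
      ultimately show ?thesis
        using Finite_Set.bex_max_element[OF fin _ _ \<open>I \<noteq> {}\<close>, of ?R] by metis
    qed
    then obtain m where m: "m \<in> I" "\<And>t. t \<in> I \<Longrightarrow> nat_le m t \<Longrightarrow> t = m"
      by blast
    let ?x = "germ m (principal_char (star m * m))"
    have "?x \<in> bisection m (D (star m * m))"
      using principal_char_in_D[OF star_mult_idem(1)] by (auto simp: bisection_def)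
    moreover have "?x \<notin> bisection t (D (star t * t))" if "t \<in> I" "t \<noteq> m" for t
      using m that germ_eq_imp_nat_le by (auto simp: bisection_def)
    ultimately have "(\<Sum>s\<in>I. (Poly_Mapping.lookup a s - Poly_Mapping.lookup b s) *
        indicator (bisection s (D (star s * s))) ?x) = Poly_Mapping.lookup a m - Poly_Mapping.lookup b m"
      using m fin by (subst sum.remove[of _ m]) auto
    then show False
      using zero[of ?x] m(1) by (simp add: I_def)
  qed
  then show "a = b"
    by (intro poly_mapping_eqI) (metis (mono_tags, lifting) I_def UnCI empty_iff in_keys_iff mem_Collect_eq)
qed

end

theory Submission
  imports Defs
begin

text \<open>Write \<open>e\<^sub>0 > e\<^sub>1 > \<dots>\<close> for the idempotents. The characters are \<open>\<theta>\<^sub>n\<close>, which is \<open>1\<close> exactly at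
  \<open>e\<^sub>0, \<dots>, e\<^sub>n\<close>, and the constant character \<open>\<theta>\<^sub>\<infinity>\<close>, the limit of the \<open>\<theta>\<^sub>n\<close>. A compact open set \<open>U\<close> is
  clopen, so for large \<open>m\<close> its characteristic function is
  \<open>(\<Sum>j<m. [\<theta>\<^sub>j \<in> U] (e\<^sub>j - e\<^sub>j\<^sub>+\<^sub>1)) + [\<theta>\<^sub>\<infinity> \<in> U] e\<^sub>m\<close> in the semigroup algebra. If some
  \<open>w = e\<^sub>n v - e\<^sub>n\<^sub>+\<^sub>1 v\<close> is non-zero, this element fixes \<open>w\<close> whenever \<open>\<theta>\<^sub>n \<in> U\<close>, so \<open>w\<close> lies in the
  restriction at \<open>\<theta>\<^sub>n\<close>. Otherwise all \<open>e\<^sub>n\<close> act like \<open>e\<^sub>0\<close>, which acts as the identity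
  by non-degeneracy, and the restriction at \<open>\<theta>\<^sub>\<infinity>\<close> is the whole module.\<close>

section \<open>Idempotents as units of the groupoid\<close>

lemma openin_D:
  fixes e :: "'s::inverse_semigroup"
  assumes "e \<in> idempotents"
  shows "openin spectrum_topology (D e)"
proof -
  let ?P = "product_topology (\<lambda>_. discrete_topology {0, 1::nat}) (idempotents :: 's set)"
  have "openin ?P {\<theta> \<in> topspace ?P. \<theta> e \<in> {1}}"
    by (rule openin_continuous_map_preimage[OF continuous_map_product_projection[OF assms]]) simp
  moreover have "D e = {\<theta> \<in> topspace ?P. \<theta> e \<in> {1}} \<inter> spectrum"
    by (auto simp: D_def spectrum_def)
  ultimately show ?thesis
    unfolding spectrum_topology_def openin_subtopology by blast
qed

lemma topspace_spectrum_topology: "topspace spectrum_topology = spectrum"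
  by (auto simp: spectrum_topology_def spectrum_def)

lemma Hausdorff_spectrum_topology: "Hausdorff_space spectrum_topology"
  unfolding spectrum_topology_def
  by (intro Hausdorff_space_subtopology) (simp add: Hausdorff_space_product_topology)

lemma D_mult:
  assumes "e \<in> idempotents" "f \<in> idempotents"
  shows "D (e * f) = D e \<inter> D f"
  using assms by (auto simp: D_def spectrum_def)

section \<open>Germs at idempotents\<close>

lemma star_mult_self_idem:
  assumes "e \<in> idempotents"
  shows "star e * e = e"
  using assms by (simp add: star_idem) (simp add: idempotents_def)

lemma nat_le_idem_mult:
  assumes "e \<in> idempotents"
  shows "nat_le (e * s) s"
  using assms by (auto simp: nat_le_def)

text \<open>The order supplies some idempotent \<open>g\<close> with \<open>u = g * s\<close>; as
  \<open>u\<close> absorbs \<open>g\<close>, it can itself take the place of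
  \<open>g\<close>.\<close>

lemma nat_le_idem_left:
  assumes "u \<in> idempotents" "nat_le u s"
  shows "u * s = u"
proof -
  obtain g where g: "g \<in> idempotents" "u = g * s"
    using assms(2) by (auto simp: nat_le_def)
  have "g * u = u"
    using g by (simp add: idempotents_def flip: mult.assoc)
  then have "u * g = u"
    using idem_commute[OF g(1) assms(1)] by simp
  then have "u * s = u * (g * s)"
    by (simp flip: mult.assoc)
  also have "\<dots> = u"
    using assms(1) by (simp flip: g(2) add: idempotents_def)
  finally show ?thesis .
qed

text \<open>A germ depends only on the element near \<open>\<theta>\<close>. The images under
  \<open>germ_rel\<close> are compared directly: \<open>s\<close> and its restriction
  \<open>u\<close> have a common lower bound at \<open>\<theta>\<close> with exactly the same
  \<open>t\<close>.\<close>

lemma germ_nat_le_idem: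
  assumes u: "u \<in> idempotents" and us: "nat_le u s" and \<theta>: "\<theta> \<in> D u" "\<theta> \<in> D (star s * s)"
  shows "germ s \<theta> = germ u \<theta>"
proof -
  have "(\<exists>w. nat_le w s \<and> nat_le w t \<and> \<theta> \<in> D (star w * w)) \<longleftrightarrow>
      (\<exists>w. nat_le w u \<and> nat_le w t \<and> \<theta> \<in> D (star w * w))" for t
  proof
    assume "\<exists>w. nat_le w s \<and> nat_le w t \<and> \<theta> \<in> D (star w * w)"
    then obtain w where w: "nat_le w s" "nat_le w t" "\<theta> \<in> D (star w * w)"
      by blast
    \<comment> \<open>The new lower bound is \<open>u * w\<close>. It equals \<open>u * ?h\<close>,
      hence is an idempotent with domain \<open>D u \<inter> D ?h\<close>, which contains
      \<open>\<theta>\<close>.\<close>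
    let ?h = "star w * w"
    have h: "?h \<in> idempotents"
      by (rule star_mult_idem)
    have "u * w = u * (s * ?h)"
      using nat_le_right[OF w(1)] by (rule arg_cong)
    also have "\<dots> = u * ?h"
      by (simp add: nat_le_idem_left[OF u us] flip: mult.assoc[of u s])
    finally have uw: "u * w = u * ?h" .
    have "star (u * w) * (u * w) = u * ?h"
      unfolding uw by (rule star_mult_self_idem[OF idem_mult[OF u h]])
    then have "\<theta> \<in> D (star (u * w) * (u * w))"
      using \<theta>(1) w(3) by (simp add: D_mult[OF u h])
    moreover have "nat_le (u * w) u"
      unfolding uw idem_commute[OF u h] by (rule nat_le_idem_mult[OF h])
    moreover have "nat_le (u * w) t"
      using nat_le_trans[OF nat_le_idem_mult[OF u] w(2)] .
    ultimately show "\<exists>w. nat_le w u \<and> nat_le w t \<and> \<theta> \<in> D (star w * w)"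
      by blast
  next
    assume "\<exists>w. nat_le w u \<and> nat_le w t \<and> \<theta> \<in> D (star w * w)"
    then show "\<exists>w. nat_le w s \<and> nat_le w t \<and> \<theta> \<in> D (star w * w)"
      using us nat_le_trans by blast
  qed
  then show ?thesis
    using \<theta> star_mult_self_idem[OF u] by (auto simp: germ_def germ_rel_def)
qed

text \<open>Both germs equal that of the common lower bound \<open>e * f\<close>. Hence the unit at
  a character does not depend on the idempotent representing it.\<close>

lemma germ_idem_eq:
  assumes "e \<in> idempotents" "f \<in> idempotents" "\<theta> \<in> D e" "\<theta> \<in> D f"
  shows "germ e \<theta> = germ f \<theta>"
proof -
  have "\<theta> \<in> D (e * f)"
    using assms by (simp add: D_mult)
  moreover have "nat_le (e * f) e"
    unfolding idem_commute[OF assms(1,2)] by (rule nat_le_idem_mult[OF assms(2)])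
  moreover have "nat_le (e * f) f"
    by (rule nat_le_idem_mult[OF assms(1)])
  ultimately have "germ e \<theta> = germ (e * f) \<theta>" "germ f \<theta> = germ (e * f) \<theta>"
    using assms by (simp_all add: germ_nat_le_idem idem_mult star_mult_self_idem)
  then show ?thesis
    by simp
qed

text \<open>A germ contains its own representative, so equality of classes gives back the defining
  relation.\<close>

lemma germ_eqD:
  assumes "germ s \<theta> = germ t \<theta>'" "\<theta> \<in> D (star s * s)"
  shows "\<theta> = \<theta>'" "\<exists>u. nat_le u s \<and> nat_le u t \<and> \<theta> \<in> D (star u * u)"
proof -
  have "(s, \<theta>) \<in> germ s \<theta>"
    using assms(2) nat_le_refl by (auto simp: germ_def germ_rel_def)
  then have "((t, \<theta>'), (s, \<theta>)) \<in> germ_rel"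
    by (simp add: assms(1)) (simp add: germ_def)
  then show "\<theta> = \<theta>'" "\<exists>u. nat_le u s \<and> nat_le u t \<and> \<theta> \<in> D (star u * u)"
    by (auto simp: germ_rel_def)
qed

lemma inj_on_germ: "inj_on (germ s) (D (star s * s))"
  by (rule inj_onI) (rule germ_eqD(1))

lemma nat_le_idem_imp_idem:
  assumes "e \<in> idempotents" "nat_le u e"
  shows "u \<in> idempotents"
  using assms idem_mult by (auto simp: nat_le_def)

section \<open>The groupoid topology on units\<close>

lemma openin_bisection:
  assumes "openin spectrum_topology U" "U \<subseteq> D (star s * s)"
  shows "openin groupoid_topology (bisection s U)"
  unfolding groupoid_topology_def using assms by (intro topology_generated_by_Basis) blast

lemma continuous_map_germ_idem:
  fixes e :: "'s::inverse_semigroup"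
  assumes e: "e \<in> idempotents"
  shows "continuous_map (subtopology spectrum_topology (D e)) groupoid_topology (germ e)"
proof -
  let ?X = "subtopology spectrum_topology (D e)"
  have top: "topspace ?X = D e"
    by (auto simp: topspace_spectrum_topology D_def)
  have ee: "star e * e = e"
    by (rule star_mult_self_idem[OF e])
  show ?thesis
    unfolding groupoid_topology_def
  proof (rule continuous_on_generated_topo)
    fix B :: "'s germ set"
    assume "B \<in> {bisection s U | s U. openin spectrum_topology U \<and> U \<subseteq> D (star s * s)}"
    then obtain s U where B: "B = bisection s U" and U: "openin spectrum_topology U" "U \<subseteq> D (star s * s)"
      by blast
    \<comment> \<open>The germs of \<open>e\<close> and \<open>s\<close> at \<open>\<theta>\<close>
      agree exactly when some idempotent \<open>u\<close> below both has
      \<open>\<theta> \<in> D u\<close>, so the preimage is a union of open sets.\<close>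
    let ?N = "\<Union>u\<in>{u \<in> idempotents. nat_le u e \<and> nat_le u s}. D u \<inter> U"
    have "germ e -` B \<inter> topspace ?X = ?N \<inter> D e"
    proof (intro equalityI subsetI)
      fix \<theta> assume "\<theta> \<in> germ e -` B \<inter> topspace ?X"
      then obtain \<theta>' where *: "\<theta> \<in> D e" "\<theta>' \<in> U" "germ e \<theta> = germ s \<theta>'"
        by (auto simp: B bisection_def top)
      then obtain u where u: "nat_le u e" "nat_le u s" "\<theta> \<in> D (star u * u)" and "\<theta> = \<theta>'"
        using germ_eqD[of e \<theta> s \<theta>'] unfolding ee by blast
      moreover have "u \<in> idempotents"
        by (rule nat_le_idem_imp_idem[OF e u(1)])
      ultimately show "\<theta> \<in> ?N \<inter> D e"
        using * by (auto simp: star_mult_self_idem)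
    next
      fix \<theta> assume "\<theta> \<in> ?N \<inter> D e"
      then obtain u where u: "u \<in> idempotents" "nat_le u s" "\<theta> \<in> D u" "\<theta> \<in> U" "\<theta> \<in> D e"
        by blast
      have "germ e \<theta> = germ u \<theta>"
        using e u by (intro germ_idem_eq)
      also have "\<dots> = germ s \<theta>"
        using germ_nat_le_idem u U by blast
      finally show "\<theta> \<in> germ e -` B \<inter> topspace ?X"
        using u top by (auto simp: B bisection_def)
    qed
    moreover have "openin spectrum_topology ?N"
      using U(1) by (intro openin_Union) (auto intro: openin_D)
    ultimately show "openin ?X (germ e -` B \<inter> topspace ?X)"
      by (auto simp: openin_subtopology)
  next
    show "germ e ` topspace ?X
        \<subseteq> \<Union> {bisection s U | s U. openin spectrum_topology U \<and> U \<subseteq> D (star s * s)}"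
    proof -
      have "bisection e (D e) \<in> {bisection s U | s U. openin spectrum_topology U \<and> U \<subseteq> D (star s * s)}"
        using openin_D[OF e] ee by (intro CollectI exI[of _ e] exI[of _ "D e"]) simp
      then show ?thesis
        unfolding top bisection_def by (rule Union_upper)
    qed
  qed
qed

text \<open>The groupoid as a whole may fail to be Hausdorff, but on \<open>D e\<close> the map
  \<open>germ e\<close> is injective and carries open subsets to open bisections, so a separation of
  characters passes to their germs.\<close>

lemma Hausdorff_bisection_idem:
  fixes e :: "'s::inverse_semigroup"
  assumes e: "e \<in> idempotents" and U: "openin spectrum_topology U" "U \<subseteq> D e"
  shows "Hausdorff_space (subtopology groupoid_topology (bisection e U))"
  unfolding Hausdorff_space_def
proof (intro allI impI, elim conjE)
  let ?X = "subtopology groupoid_topology (bisection e U)"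
  have ee: "star e * e = e"
    by (rule star_mult_self_idem[OF e])
  fix x y assume "x \<in> topspace ?X" "y \<in> topspace ?X" "x \<noteq> y"
  then obtain \<theta> \<theta>' where x: "x = germ e \<theta>" "\<theta> \<in> U" and y: "y = germ e \<theta>'" "\<theta>' \<in> U" and "\<theta> \<noteq> \<theta>'"
    by (auto simp: bisection_def)
  moreover have "\<theta> \<in> topspace spectrum_topology" "\<theta>' \<in> topspace spectrum_topology"
    using U(1) x y openin_subset by blast+
  ultimately obtain P Q where PQ: "openin spectrum_topology P" "openin spectrum_topology Q"
    "\<theta> \<in> P" "\<theta>' \<in> Q" "disjnt P Q"
    using Hausdorff_spectrum_topology unfolding Hausdorff_space_def by meson
  let ?P = "bisection e (P \<inter> U)" and ?Q = "bisection e (Q \<inter> U)"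
  have "openin ?X (bisection e (R \<inter> U))" if "openin spectrum_topology R" for R
  proof -
    have "openin groupoid_topology (bisection e (R \<inter> U))" "openin groupoid_topology (bisection e U)"
      using that U ee by (auto intro!: openin_bisection)
    moreover have "bisection e (R \<inter> U) \<subseteq> bisection e U"
      by (auto simp: bisection_def)
    ultimately show ?thesis
      by (simp add: openin_open_subtopology)
  qed
  moreover have "disjnt ?P ?Q"
    using PQ(5) U inj_on_germ[of e] unfolding ee
    by (auto simp: disjnt_def bisection_def inj_on_def) blast
  ultimately show "\<exists>A B. openin ?X A \<and> openin ?X B \<and> x \<in> A \<and> y \<in> B \<and> disjnt A B"
    using PQ x y by (intro exI[of _ ?P] exI[of _ ?Q]) (auto simp: bisection_def)
qed

lemma module_fun: "module (\<lambda>(c::'k::comm_ring_1) (f :: 'a \<Rightarrow> 'k) x. c * f x)"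
  by unfold_locales (auto simp: algebra_simps fun_eq_iff)

text \<open>The required open Hausdorff subspace is the bisection itself: there the indicator is
  constantly 1 and its support is the whole subspace, compact as the continuous image of
  \<open>U\<close>.\<close>

lemma indicator_bisection_idem_in_groupoid_algebra:
  fixes e :: "'s::inverse_semigroup"
  assumes e: "e \<in> idempotents" and U: "openin spectrum_topology U" "U \<subseteq> D e"
    and comp: "compactin spectrum_topology U"
  shows "(indicator (bisection e U) :: 's germ \<Rightarrow> 'k::comm_ring_1) \<in> groupoid_algebra"
  unfolding groupoid_algebra_def
proof (rule module.span_base[OF module_fun], intro CollectI exI conjI)
  let ?V = "bisection e U" and ?X = "subtopology groupoid_topology (bisection e U)"
  let ?f = "indicator (bisection e U) :: 's germ \<Rightarrow> 'k"
  show V: "openin groupoid_topology ?V"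
    using U star_mult_self_idem[OF e] by (intro openin_bisection) simp_all
  show "Hausdorff_space ?X"
    by (rule Hausdorff_bisection_idem[OF e U])
  show "\<forall>x. x \<notin> ?V \<longrightarrow> ?f x = 0"
    by simp
  have top: "topspace ?X = ?V"
    using openin_subset[OF V] by auto
  have "continuous_map ?X (discrete_topology UNIV) (\<lambda>_. 1 :: 'k)"
    by simp
  then show "continuous_map ?X (discrete_topology UNIV) ?f"
    by (rule continuous_map_eq) (simp add: top)
  have "compactin groupoid_topology ?V"
    unfolding bisection_def
    by (rule image_compactin[OF _ continuous_map_germ_idem[OF e]])
      (simp add: compactin_subtopology comp U)
  then have "compactin ?X ?V"
    by (simp add: compactin_subtopology)
  moreover have "{x \<in> ?V. ?f x \<noteq> 0} = ?V"
    by auto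
  moreover have "?X closure_of ?V = ?V"
    using closure_of_topspace[of ?X] unfolding top .
  ultimately show "compactin ?X (?X closure_of {x \<in> ?V. ?f x \<noteq> 0})"
    by simp
qed

lemma unit_germs_eq_bisection:
  assumes "e \<in> idempotents" "U \<subseteq> D e"
  shows "unit_germs U = bisection e U"
proof
  show "unit_germs U \<subseteq> bisection e U"
  proof
    fix x assume "x \<in> unit_germs U"
    then obtain f \<theta> where "f \<in> idempotents" "\<theta> \<in> U" "\<theta> \<in> D f" "x = germ f \<theta>"
      by (auto simp: unit_germs_def bisection_def)
    then show "x \<in> bisection e U"
      using germ_idem_eq[OF _ assms(1)] assms(2) by (auto simp: bisection_def)
  qed
  show "bisection e U \<subseteq> unit_germs U"
    using assms by (auto simp: unit_germs_def bisection_def)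
qed

section \<open>The semigroup algebra\<close>

lemma to_groupoid_algebra_superset:
  assumes "finite A" "Poly_Mapping.keys a \<subseteq> A"
  shows "to_groupoid_algebra a x =
    (\<Sum>s\<in>A. Poly_Mapping.lookup a s * indicator (bisection s (D (star s * s))) x)"
  unfolding to_groupoid_algebra_def
  using assms by (intro sum.mono_neutral_left) (auto simp: in_keys_iff)

lemma to_groupoid_algebra_add:
  "to_groupoid_algebra (a + b) x = to_groupoid_algebra a x + to_groupoid_algebra b x"
proof -
  let ?A = "Poly_Mapping.keys a \<union> Poly_Mapping.keys b"
  have "finite ?A" "Poly_Mapping.keys (a + b) \<subseteq> ?A"
    by (simp_all add: Poly_Mapping.keys_add)
  then show ?thesis
    by (simp add: to_groupoid_algebra_superset[of ?A] lookup_add distrib_right sum.distrib)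
qed

lemma to_groupoid_algebra_diff:
  "to_groupoid_algebra (a - b) x = to_groupoid_algebra a x - to_groupoid_algebra b x"
  using to_groupoid_algebra_add[of "a - b" b x] by simp

lemma to_groupoid_algebra_zero: "to_groupoid_algebra 0 x = 0"
  by (simp add: to_groupoid_algebra_def)

lemma to_groupoid_algebra_sum:
  "to_groupoid_algebra (\<Sum>i\<in>I. f i) x = (\<Sum>i\<in>I. to_groupoid_algebra (f i) x)"
  by (induction I rule: infinite_finite_induct)
    (simp_all add: to_groupoid_algebra_add to_groupoid_algebra_zero)

lemma to_groupoid_algebra_single:
  "to_groupoid_algebra (Poly_Mapping.single s c) x = c * indicator (bisection s (D (star s * s))) x"
  \<comment> \<open>The index set \<open>{s}\<close> also covers \<open>c = 0\<close>, where the set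
    of keys is empty.\<close>
  by (subst to_groupoid_algebra_superset[of "{s}"]) (simp_all del: sum_mult_indicator)

lemma sg_mult_single_single:
  "sg_mult (Poly_Mapping.single s c) (Poly_Mapping.single t d) = Poly_Mapping.single (s * t) (c * d)"
  by (simp add: sg_mult_def)

lemma sg_mult_left_unit:
  fixes a :: "'s::inverse_semigroup \<Rightarrow>\<^sub>0 'k::comm_ring_1"
  assumes "\<And>t. s * t = t"
  shows "sg_mult (Poly_Mapping.single s 1) a = a"
proof (rule poly_mapping_eqI)
  fix k
  have "Poly_Mapping.lookup (sg_mult (Poly_Mapping.single s 1) a) k =
      (\<Sum>t\<in>Poly_Mapping.keys a. if t = k then Poly_Mapping.lookup a t else 0)"
    by (simp add: sg_mult_def assms lookup_sum lookup_single when_def)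
  also have "\<dots> = Poly_Mapping.lookup a k"
    by (simp add: in_keys_iff)
  finally show "Poly_Mapping.lookup (sg_mult (Poly_Mapping.single s 1) a) k = Poly_Mapping.lookup a k" .
qed

section \<open>Consequences of the module axioms\<close>

context semigroup_algebra_module
begin

lemma act_zero_left: "act 0 v = 0"
  using act_add_left[of 0 0 v] by simp

lemma act_diff_left: "act (a - b) v = act a v - act b v"
  using act_add_left[of "a - b" b v] by simp

lemma act_sum_left: "act (\<Sum>i\<in>I. f i) v = (\<Sum>i\<in>I. act (f i) v)"
  by (induction I rule: infinite_finite_induct) (simp_all add: act_add_left act_zero_left)

lemma act_zero_right: "act a 0 = 0"
  using act_add_right[of a 0 0] by simp

lemma act_diff_right: "act a (v - w) = act a v - act a w"
  using act_add_right[of a "v - w" w] by simp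

text \<open>The vectors fixed by \<open>s\<close> form a submodule containing every
  \<open>act a v\<close>; by non-degeneracy it is everything.\<close>

lemma act_left_unit:
  assumes "\<And>t. s * t = t"
  shows "act (Poly_Mapping.single s 1) v = v"
proof -
  have "v \<in> span {act a v | a v. True}"
    unfolding nondegenerate ..
  then show ?thesis
  proof (induction rule: span_induct)
    case base
    show ?case
      by (simp add: subspace_def act_zero_right act_add_right act_scale_right)
  next
    case (step x)
    then show ?case
      by (auto simp: sg_mult_left_unit[OF assms] simp flip: act_mult)
  qed
qed

end

section \<open>Chains of idempotents\<close>

locale idempotent_chain =
  fixes e :: "nat \<Rightarrow> 's::inverse_semigroup"
  assumes bij: "bij_betw e UNIV idempotents"
    and mult_max: "e i * e j = e (max i j)"
begin

lemma e_idem [simp]: "e i \<in> idempotents"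
  using bij by (auto simp: bij_betw_def)

lemma idempotentE:
  assumes "f \<in> idempotents"
  obtains i where "f = e i"
  using assms bij by (auto simp: bij_betw_def)

lemma e_eq_iff: "e i = e j \<longleftrightarrow> i = j"
  using bij by (auto simp: bij_betw_def inj_on_def)

text \<open>Every \<open>s * star s\<close> lies in the chain, and all members of the chain absorb
  its top \<open>e 0\<close>.\<close>

lemma e_0_unit: "e 0 * s = s"
proof -
  obtain i where i: "s * star s = e i"
    using idempotentE[OF star_mult_idem(2)] by blast
  have "e 0 * s = e 0 * (s * star s) * s"
    using star_props(1)[of s] by (simp add: mult.assoc)
  also have "\<dots> = s"
    using star_props(1)[of s] by (simp add: i mult_max)
  finally show ?thesis .
qed

section \<open>Classification and convergence of the characters\<close>

abbreviation fin_char :: "nat \<Rightarrow> 's \<Rightarrow> nat" where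
  "fin_char n \<equiv> principal_char (e n)"

text \<open>Restricted to the idempotents because characters are extensional. It is not principal,
  as the chain has no least element.\<close>

definition inf_char :: "'s \<Rightarrow> nat" where
  "inf_char = (\<lambda>f\<in>idempotents. 1)"

lemma fin_char_e: "fin_char n (e i) = (if i \<le> n then 1 else 0)"
  by (simp add: principal_char_def mult_max e_eq_iff max_def)

lemma inf_char_e: "inf_char (e i) = 1"
  by (simp add: inf_char_def)

lemma fin_char_in_spectrum: "fin_char n \<in> spectrum"
  using principal_char_in_D[OF e_idem] by (auto simp: D_def)

lemma inf_char_in_spectrum: "inf_char \<in> spectrum"
proof -
  have "\<exists>f. f \<in> (idempotents :: 's set)"
    using e_idem by blast
  then show ?thesis
    by (auto simp: spectrum_def inf_char_def idem_mult)
qed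

lemma char_eqI:
  assumes "\<theta> \<in> spectrum" "\<theta>' \<in> spectrum" "\<And>i. \<theta> (e i) = \<theta>' (e i)"
  shows "\<theta> = \<theta>'"
proof (rule PiE_ext)
  show "\<theta> \<in> idempotents \<rightarrow>\<^sub>E {0, 1}" "\<theta>' \<in> idempotents \<rightarrow>\<^sub>E {0, 1}"
    using assms by (auto simp: spectrum_def)
  show "\<theta> f = \<theta>' f" if "f \<in> idempotents" for f
    using that assms(3) idempotentE by metis
qed

text \<open>The indices at which a character vanishes form an up-set. If non-empty, it has a least
  element \<open>m\<close>, which is positive since the character is not zero, and the character is
  \<open>fin_char (m - 1)\<close>.\<close>

lemma spectrum_cases:
  assumes "\<theta> \<in> spectrum"
  obtains n where "\<theta> = fin_char n" | "\<theta> = inf_char"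
proof (cases "\<forall>i. \<theta> (e i) = 1")
  case True
  then have "\<theta> = inf_char"
    using char_eqI[OF assms inf_char_in_spectrum] by (simp add: inf_char_e)
  then show thesis
    by (rule that)
next
  case False
  have hom: "\<theta> (e (max i j)) = \<theta> (e i) * \<theta> (e j)" for i j
    unfolding mult_max[symmetric] using assms e_idem by (simp add: spectrum_def)
  have val: "\<theta> (e i) \<in> {0, 1}" for i
    using assms by (auto simp: spectrum_def dest: PiE_mem[OF _ e_idem])
  obtain k where k: "\<theta> (e k) \<noteq> 0"
  proof -
    obtain f where "f \<in> idempotents" "\<theta> f \<noteq> 0"
      using assms by (auto simp: spectrum_def)
    then show thesis
      using that idempotentE[of f] by blast
  qed
  have zero_up: "\<theta> (e j) = 0" if "\<theta> (e i) = 0" "i \<le> j" for i j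
    using hom[of i j] that by (simp add: max_def split: if_splits)
  define m where "m = (LEAST i. \<theta> (e i) = 0)"
  have "\<exists>i. \<theta> (e i) = 0"
    using False val by auto
  then have m0: "\<theta> (e m) = 0"
    unfolding m_def by (rule LeastI_ex)
  have "m \<noteq> 0"
    using zero_up[of m k] m0 k by (intro notI) simp
  then obtain n where n: "m = Suc n"
    using not0_implies_Suc by blast
  have "\<theta> (e i) = fin_char n (e i)" for i
  proof (cases "i \<le> n")
    case True
    then have "\<theta> (e i) \<noteq> 0"
      using not_less_Least[of i "\<lambda>i. \<theta> (e i) = 0"] n by (simp add: m_def[symmetric])
    then show ?thesis
      using True val[of i] by (simp add: fin_char_e)
  next
    case False
    then show ?thesis
      using zero_up[OF m0] n by (simp add: fin_char_e)
  qed
  then have "\<theta> = fin_char n"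
    by (rule char_eqI[OF assms fin_char_in_spectrum])
  then show thesis
    by (rule that)
qed

text \<open>Lets the germs of the single idempotent \<open>e 0\<close> parametrise all
  units.\<close>

lemma D_e_0: "D (e 0) = spectrum"
proof -
  have "\<theta> (e 0) = 1" if "\<theta> \<in> spectrum" for \<theta>
    using that by (cases rule: spectrum_cases) (simp_all add: fin_char_e inf_char_e)
  then show ?thesis
    by (auto simp: D_def)
qed

text \<open>Convergence is pointwise, and at \<open>e i\<close> the sequence is constantly 1 from
  \<open>n = i\<close> on.\<close>

lemma limitin_fin_char: "limitin spectrum_topology fin_char inf_char sequentially"
  unfolding spectrum_topology_def limitin_subtopology
proof (intro conjI)
  show "limitin (product_topology (\<lambda>_. discrete_topology {0, 1}) idempotents) fin_char inf_char sequentially"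
    unfolding limitin_componentwise
  proof (intro conjI ballI)
    show "inf_char \<in> extensional idempotents"
      by (simp add: inf_char_def)
    show "\<forall>\<^sub>F n in sequentially. fin_char n \<in> topspace (product_topology (\<lambda>_. discrete_topology {0, 1}) idempotents)"
      using fin_char_in_spectrum by (intro always_eventually) (auto simp: spectrum_def)
    fix f :: 's assume "f \<in> idempotents"
    then obtain i where i: "f = e i"
      using idempotentE by blast
    have "\<forall>\<^sub>F n in sequentially. fin_char n f = inf_char f"
      using eventually_ge_at_top[of i] by eventually_elim (simp add: i fin_char_e inf_char_e)
    then show "limitin (discrete_topology {0, 1}) (\<lambda>n. fin_char n f) (inf_char f) sequentially"
      by (auto simp: limitin_def i inf_char_e elim!: eventually_mono)
  qed
qed (simp_all add: inf_char_in_spectrum fin_char_in_spectrum)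

text \<open>A compact set in a Hausdorff space is closed, so \<open>U\<close> and its complement are
  both open; whichever contains the limit \<open>inf_char\<close> eventually contains the
  sequence.\<close>

lemma eventually_fin_char_mem_iff:
  assumes "openin spectrum_topology U" "compactin spectrum_topology U"
  shows "\<forall>\<^sub>F n in sequentially. fin_char n \<in> U \<longleftrightarrow> inf_char \<in> U"
proof (cases "inf_char \<in> U")
  case True
  then show ?thesis
    using limitin_fin_char assms(1) by (auto simp: limitin_def elim: eventually_mono)
next
  case False
  have "openin spectrum_topology (spectrum - U)"
    using compactin_imp_closedin[OF Hausdorff_spectrum_topology assms(2)]
    by (simp add: closedin_def topspace_spectrum_topology)
  then have "\<forall>\<^sub>F n in sequentially. fin_char n \<in> spectrum - U"
    using limitin_fin_char False inf_char_in_spectrum by (auto simp: limitin_def)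
  then show ?thesis
    using False by (auto elim: eventually_mono)
qed

section \<open>Compact open sets as elements of the semigroup algebra\<close>

text \<open>The difference at \<open>j\<close> represents the point \<open>fin_char j\<close>, and
  \<open>e m\<close> the tail of \<open>inf_char\<close> and all \<open>fin_char n\<close> with
  \<open>n \<ge> m\<close>. The whole represents \<open>U\<close> once this tail lies entirely
  inside or outside \<open>U\<close>.\<close>

definition unit_element :: "('s \<Rightarrow> nat) set \<Rightarrow> nat \<Rightarrow> 's \<Rightarrow>\<^sub>0 'k::comm_ring_1" where
  "unit_element U m =
     (\<Sum>j | j < m \<and> fin_char j \<in> U. Poly_Mapping.single (e j) 1 - Poly_Mapping.single (e (Suc j)) 1) +
     (if inf_char \<in> U then Poly_Mapping.single (e m) 1 else 0)"

text \<open>A germ determines its character, and at characters in \<open>D (e j)\<close> the germs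
  of \<open>e 0\<close> and \<open>e j\<close> coincide. Evaluation at a unit thus reduces to values
  of its character.\<close>

lemma indicator_bisection_e:
  assumes "\<theta> \<in> spectrum"
  shows "(indicator (bisection (e j) (D (star (e j) * e j))) (germ (e 0) \<theta>) :: 'k::comm_ring_1) =
    of_nat (\<theta> (e j))"
proof -
  have "germ (e 0) \<theta> \<in> bisection (e j) (D (e j)) \<longleftrightarrow> \<theta> \<in> D (e j)"
  proof
    assume "germ (e 0) \<theta> \<in> bisection (e j) (D (e j))"
    then obtain \<theta>' where "\<theta>' \<in> D (e j)" "germ (e 0) \<theta> = germ (e j) \<theta>'"
      by (auto simp: bisection_def)
    then show "\<theta> \<in> D (e j)"
      using germ_eqD(1)[of "e 0" \<theta>] assms by (simp add: star_mult_self_idem D_e_0)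
  next
    assume "\<theta> \<in> D (e j)"
    then show "germ (e 0) \<theta> \<in> bisection (e j) (D (e j))"
      using germ_idem_eq[of "e 0" "e j" \<theta>] assms by (auto simp: bisection_def D_e_0)
  qed
  moreover have "\<theta> (e j) = (if \<theta> \<in> D (e j) then 1 else 0)"
    using assms
    by (cases rule: spectrum_cases)
      (auto simp: D_def fin_char_e inf_char_e fin_char_in_spectrum inf_char_in_spectrum)
  ultimately show ?thesis
    by (simp add: star_mult_self_idem)
qed

lemma to_groupoid_algebra_unit_element_germ:
  assumes m: "\<And>n. n \<ge> m \<Longrightarrow> fin_char n \<in> U \<longleftrightarrow> inf_char \<in> U" and \<theta>: "\<theta> \<in> spectrum"
  shows "to_groupoid_algebra (unit_element U m :: 's \<Rightarrow>\<^sub>0 'k::comm_ring_1) (germ (e 0) \<theta>) = indicator U \<theta>"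
proof -
  let ?J = "{j. j < m \<and> fin_char j \<in> U}"
  have eq: "to_groupoid_algebra (unit_element U m :: 's \<Rightarrow>\<^sub>0 'k) (germ (e 0) \<theta>) =
      (\<Sum>j\<in>?J. of_nat (\<theta> (e j)) - of_nat (\<theta> (e (Suc j)))) + (if inf_char \<in> U then of_nat (\<theta> (e m)) else 0)"
    by (simp add: unit_element_def to_groupoid_algebra_add to_groupoid_algebra_sum
        to_groupoid_algebra_diff to_groupoid_algebra_single to_groupoid_algebra_zero
        indicator_bisection_e[OF \<theta>])
  from \<theta> show ?thesis
  proof (cases rule: spectrum_cases)
    case (1 n)
    have "(\<Sum>j\<in>?J. of_nat (\<theta> (e j)) - of_nat (\<theta> (e (Suc j)))) = (\<Sum>j\<in>?J. if j = n then 1 else 0 :: 'k)"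
      by (intro sum.cong) (auto simp: 1 fin_char_e)
    also have "\<dots> = (if n < m \<and> fin_char n \<in> U then 1 else 0)"
      by (subst sum.delta) auto
    \<comment> \<open>For \<open>n < m\<close> the sum decides membership and the tail term
      vanishes. For \<open>n \<ge> m\<close> the sum is zero, and \<open>m\<close> reduces
      membership of \<open>fin_char n\<close> to that of \<open>inf_char\<close>.\<close>
    finally show ?thesis
      using m[of n] unfolding eq by (auto simp: 1 fin_char_e indicator_def)
  next
    case 2
    then show ?thesis
      unfolding eq by (simp add: inf_char_e)
  qed
qed

lemma to_groupoid_algebra_unit_element:
  assumes m: "\<And>n. n \<ge> m \<Longrightarrow> fin_char n \<in> U \<longleftrightarrow> inf_char \<in> U" and U: "U \<subseteq> spectrum"
  shows "to_groupoid_algebra (unit_element U m :: 's \<Rightarrow>\<^sub>0 'k::comm_ring_1) = indicator (unit_germs U)"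
proof
  fix x :: "'s germ"
  have U0: "unit_germs U = bisection (e 0) U"
    using U by (intro unit_germs_eq_bisection) (simp_all add: D_e_0)
  show "to_groupoid_algebra (unit_element U m :: 's \<Rightarrow>\<^sub>0 'k) x = indicator (unit_germs U) x"
  proof (cases "x \<in> germ (e 0) ` spectrum")
    case True
    then obtain \<theta> where \<theta>: "\<theta> \<in> spectrum" "x = germ (e 0) \<theta>"
      by blast
    have "x \<in> bisection (e 0) U \<longleftrightarrow> \<theta> \<in> U"
      using inj_on_germ[of "e 0"] \<theta> U
      by (auto simp: bisection_def star_mult_self_idem D_e_0 dest: inj_onD)
    then show ?thesis
      using to_groupoid_algebra_unit_element_germ[of m U \<theta>, OF m \<theta>(1)]
      by (simp add: \<theta> U0 indicator_def)
  next
    \<comment> \<open>Outside the units no bisection of an \<open>e j\<close> is met, so both sides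
      vanish.\<close>
    case False
    have "x \<notin> bisection (e j) (D (star (e j) * e j))" for j
    proof
      assume "x \<in> bisection (e j) (D (star (e j) * e j))"
      then obtain \<theta> where "\<theta> \<in> D (e j)" "x = germ (e j) \<theta>"
        by (auto simp: bisection_def star_mult_self_idem)
      moreover from this have "\<theta> \<in> spectrum"
        by (simp add: D_def)
      ultimately show False
        using germ_idem_eq[of "e 0" "e j" \<theta>] False by (auto simp: D_e_0)
    qed
    moreover have "x \<notin> unit_germs U"
      using False U by (auto simp: U0 bisection_def)
    ultimately show ?thesis
      by (simp add: unit_element_def to_groupoid_algebra_add to_groupoid_algebra_sum
        to_groupoid_algebra_diff to_groupoid_algebra_single to_groupoid_algebra_zero)
  qed
qed

text \<open>Injectivity of \<open>to_groupoid_algebra\<close> identifies the preimage of the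
  indicator. Membership in \<open>groupoid_algebra\<close> is checked as well, since
  \<open>groupoid_act\<close> is unspecified elsewhere.\<close>

lemma groupoid_act_indicator:
  assumes U: "openin spectrum_topology U" "compactin spectrum_topology U"
    and m: "\<And>n. n \<ge> m \<Longrightarrow> fin_char n \<in> U \<longleftrightarrow> inf_char \<in> U"
  shows "groupoid_act act (indicator (unit_germs U) :: 's germ \<Rightarrow> 'k::comm_ring_1) = act (unit_element U m)"
proof -
  have sub: "U \<subseteq> spectrum"
    using openin_subset[OF U(1)] by (simp add: topspace_spectrum_topology)
  have "(indicator (unit_germs U) :: 's germ \<Rightarrow> 'k) \<in> groupoid_algebra"
    using indicator_bisection_idem_in_groupoid_algebra[of "e 0" U] U sub
    by (simp add: unit_germs_eq_bisection[of "e 0"] D_e_0)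
  moreover have "inv to_groupoid_algebra (indicator (unit_germs U) :: 's germ \<Rightarrow> 'k) = unit_element U m"
    by (intro inv_f_eq inj_to_groupoid_algebra to_groupoid_algebra_unit_element m sub)
  ultimately show ?thesis
    by (simp add: groupoid_act_def)
qed

text \<open>For \<open>m\<close> past the threshold of \<open>U\<close>, a vector fixed by
  \<open>unit_element U m\<close> lies in the range of the indicator of \<open>U\<close>. The bound
  \<open>k\<close> lets a caller ask for larger \<open>m\<close>.\<close>

lemma mem_Res_groupoid_actI:
  fixes act :: "('s \<Rightarrow>\<^sub>0 'k::comm_ring_1) \<Rightarrow> 'v::ab_group_add \<Rightarrow> 'v"
  assumes "\<And>U m. \<theta> \<in> U \<Longrightarrow> k \<le> m \<Longrightarrow> act (unit_element U m) w = w"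
  shows "w \<in> Res (groupoid_act act) \<theta>"
  unfolding Res_def
proof safe
  fix U assume U: "openin spectrum_topology U" "compactin spectrum_topology U" "\<theta> \<in> U"
  obtain M where M: "\<And>n. n \<ge> M \<Longrightarrow> fin_char n \<in> U \<longleftrightarrow> inf_char \<in> U"
    using eventually_fin_char_mem_iff[OF U(1,2)] unfolding eventually_sequentially by blast
  let ?m = "max M k"
  have "groupoid_act act (indicator (unit_germs U)) = act (unit_element U ?m)"
    using M by (intro groupoid_act_indicator U) simp
  moreover have "act (unit_element U ?m) w = w"
    using assms U(3) by simp
  ultimately show "w \<in> range (groupoid_act act (indicator (unit_germs U)))"
    by (metis rangeI)
qed

end

section \<open>Existence of a non-zero restriction\<close>

theorem proposition6p35:
  fixes scale :: "'k::comm_ring_1 \<Rightarrow> 'v::ab_group_add \<Rightarrow> 'v"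
    and act :: "('s::inverse_semigroup \<Rightarrow>\<^sub>0 'k) \<Rightarrow> 'v \<Rightarrow> 'v"
  assumes "idempotents_iso_nat_ge TYPE('s)"
    and "semigroup_algebra_module scale act"
    and "\<exists>v::'v. v \<noteq> 0"
  shows "spectral (groupoid_act act)"
proof -
  interpret semigroup_algebra_module scale act
    by fact
  obtain e :: "nat \<Rightarrow> 's" where "bij_betw e UNIV idempotents" "\<And>i j. e i * e j = e (max i j)"
    using assms(1) unfolding idempotents_iso_nat_ge_def by blast
  then interpret idempotent_chain e
    by unfold_locales
  define E where "E i v = act (Poly_Mapping.single (e i) 1) v" for i v
  have EE: "E i (E j v) = E (max i j) v" for i j v
    unfolding E_def by (simp flip: act_mult add: sg_mult_single_single mult_max)
  have E0: "E 0 v = v" for v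
    unfolding E_def by (rule act_left_unit) (rule e_0_unit)
  have E_diff: "E i (v - w) = E i v - E i w" for i v w
    unfolding E_def by (rule act_diff_right)
  have act_unit: "act (unit_element U m) w =
      (\<Sum>j | j < m \<and> fin_char j \<in> U. E j w - E (Suc j) w) + (if inf_char \<in> U then E m w else 0)" for U m w
    by (simp add: unit_element_def act_add_left act_sum_left act_diff_left act_zero_left E_def)
  have "\<exists>\<theta>\<in>spectrum. \<exists>w. w \<noteq> 0 \<and> w \<in> Res (groupoid_act act) \<theta>"
  proof (cases "\<exists>n v. E n v \<noteq> E (Suc n) v")
    case True
    then obtain n v where nv: "E n v \<noteq> E (Suc n) v"
      by blast
    define w where "w = E n v - E (Suc n) v"
    \<comment> \<open>For \<open>j \<le> n\<close> both terms of \<open>w\<close> are fixed; for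
      \<open>j > n\<close> both become \<open>E j v\<close> and cancel.\<close>
    have Ew: "E j w = (if j \<le> n then w else 0)" for j
      by (auto simp: w_def E_diff EE max_def le_Suc_eq not_le)
    \<comment> \<open>Only \<open>j = n\<close> survives in the sum. The bound
      \<open>Suc n \<le> m\<close> both admits this index and makes the tail term
      \<open>E m w\<close> vanish.\<close>
    have "act (unit_element U m) w = w" if U: "fin_char n \<in> U" and m: "Suc n \<le> m" for U m
    proof -
      have "(\<Sum>j | j < m \<and> fin_char j \<in> U. E j w - E (Suc j) w) =
          (\<Sum>j | j < m \<and> fin_char j \<in> U. if j = n then w else 0)"
        by (intro sum.cong) (auto simp: Ew)
      also have "\<dots> = w"
        using U m by (subst sum.delta) auto
      finally show ?thesis
        using m by (simp add: act_unit Ew)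
    qed
    then have "w \<in> Res (groupoid_act act) (fin_char n)"
      by (rule mem_Res_groupoid_actI)
    moreover have "w \<noteq> 0"
      using nv by (simp add: w_def)
    ultimately show ?thesis
      using fin_char_in_spectrum by blast
  next
    case False
    have E_id: "E n v = v" for n v
      by (induction n) (use False E0 in auto)
    obtain v :: 'v where "v \<noteq> 0"
      using assms(3) by blast
    \<comment> \<open>Every difference kills \<open>v\<close>, while the tail term, present because
      \<open>inf_char \<in> U\<close>, returns \<open>v\<close>. This holds for every
      \<open>m\<close>, hence the bound 0.\<close>
    moreover have "v \<in> Res (groupoid_act act) inf_char"
      by (rule mem_Res_groupoid_actI[of _ 0]) (simp add: act_unit E_id)
    ultimately show ?thesis
      using inf_char_in_spectrum by blast
  qed
  then show ?thesis
    unfolding spectral_def using assms(3) by blast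
qed

end
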